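(* Let $L\ge 1$ be an integer, let $0<r,\ell<\infty$, $q=\sqrt{r/\ell}$, and let $N,M,N',M'\ge 0$ be integers with $N+M\le 2L$ and $N'+M'\le 2L$. Then there is a constant $\lambda_{N,M}^{N',M'}$, independent of $\boldsymbol{\eta}$ and $\mathbf{z}$, such that for all $\mathbf{z}\in\mathbb{S}^{2L}_{N',M'}$ and all $\boldsymbol{\eta}\in\mathbb{S}^{2L}_{N,M}$ one has the sum rule $$\left(\pi^\ast_{N',M'}(\mathbf{z})\right)^{-1}\sum_{\boldsymbol{\eta}'\in\mathbb{S}^{2L}_{N,M}}\pi^\ast_{N,M}(\boldsymbol{\eta}')\,Q_{\mathbf{z}}(\boldsymbol{\eta}')=\sum_{\mathbf{z}'\in\mathbb{S}^{2L}_{N',M'}}Q_{\mathbf{z}'}(\boldsymbol{\eta})=\lambda_{N,M}^{N',M'} .$$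
   Context: Lattice and configurations: $\Lambda=\{-L+1,\dots,L\}$, $\mathbb{S}=\{0,1,2\}$; a configuration is $\boldsymbol{\eta}=\{\eta(-L+1),\dots,\eta(L)\}\in\mathbb{S}^{2L}$, where $\eta(k)=0$ means that site $k\in\Lambda$ is occupied by a particle of type $A$, $\eta(k)=1$ that it is vacant, and $\eta(k)=2$ that it is occupied by a particle of type $B$. Local occupation variables: $a_k=\delta_{\eta(k),0}$, $b_k=\delta_{\eta(k),2}$ (the argument $\boldsymbol{\eta}$ is suppressed). Equivalently a configuration is given by its particle positions (coordinate representation) $\mathbf{z}=\{\mathbf{x},\mathbf{y}\}$, where $\mathbf{x}=\{x_1,\dots,x_{N(\mathbf{z})}\}\subseteq\Lambda$ is the set of sites occupied by $A$-particles and $\mathbf{y}=\{y_1,\dots,y_{M(\mathbf{z})}\}\subseteq\Lambda$ the (disjoint) set of sites occupied by $B$-particles; $N(\mathbf{z})=|\mathbf{x}|$, $M(\mathbf{z})=|\mathbf{y}|$. $\mathbb{S}^{2L}_{N,M}$ is the set of configurations with exactly $N$ particles of type $A$ and $M$ particles of type $B$; $\mathbf{1}_A$ is the indicator function of a set $A$. Functions: for $x,y\in\Lambda$ and $\boldsymbol{\eta}\in\mathbb{S}^{2L}$, $$Q_x^A(\boldsymbol{\eta})=q^{\sum_{k=-L+1}^{x-1}a_k-\sum_{k=x+1}^{L}a_k}\,a_x,\qquad Q_y^B(\boldsymbol{\eta})=q^{-\sum_{k=-L+1}^{y-1}b_k+\sum_{k=y+1}^{L}b_k}\,b_y,$$ $$Q_{\mathbf{z}}(\boldsymbol{\eta})=\prod_{i=1}^{N(\mathbf{z})}Q^A_{x_i}(\boldsymbol{\eta})\prod_{i=1}^{M(\mathbf{z})}Q^B_{y_i}(\boldsymbol{\eta})$$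 (empty sums are $0$, empty products are $1$). Canonical stationary distributions (the invariant measures of the two-component asymmetric simple exclusion process with hopping rates $r,\ell$ restricted to $\mathbb{S}^{2L}_{N,M}$): $$\pi(\boldsymbol{\eta}) = q^{\,\sum_{k=-L+1}^{L}(2k-1)(a_k-b_k)+\sum_{k=-L+1}^{L-1}\sum_{l=-L+1}^{k}\left(a_l b_{k+1}-b_l a_{k+1}\right)},\qquad \pi^\ast_{N,M}(\boldsymbol{\eta})=\frac{\mathbf{1}_{\mathbb{S}^{2L}_{N,M}}(\boldsymbol{\eta})}{Z_{2L}(N,M)}\pi(\boldsymbol{\eta}),$$ with $Z_{2L}(N,M)=\frac{[2L]_q!}{[N]_q!\,[M]_q!\,[2L-N-M]_q!}$, $[0]_q!=1$, $[n]_q!=\prod_{k=1}^n[k]_q$ for $n\ge 1$, and $[x]_q=\frac{q^x-q^{-x}}{q-q^{-1}}$ (with $[x]_1:=x$). Process, for reference: it is the continuous-time Markov chain on $\mathbb{S}^{2L}$ in which, for each $-L+1\le k\le L-1$, the contents of sites $k,k+1$ are interchanged at rate $r$ if they are $(A,\text{vacant})$, $(\text{vacant},B)$ or $(A,B)$, and at rate $\ell$ if they are $(\text{vacant},A)$, $(B,\text{vacant})$ or $(B,A)$. *)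

theory Defs
  imports Complex_Main "HOL-Library.FuncSet" "HOL-Library.Indicator_Function"
begin

definition sites :: "nat \<Rightarrow> int set" where
  "sites L = {- int L + 1..int L}"

text \<open>The value of a configuration at a site is 0 for a particle of type A, 1 for a vacancy
  and 2 for a particle of type B. Configurations are \<open>undefined\<close> off the lattice, so that
  they form a finite set.\<close>

type_synonym config = "int \<Rightarrow> nat"

definition configs :: "nat \<Rightarrow> config set" where
  "configs L = sites L \<rightarrow>\<^sub>E {0, 1, 2}"

definition occ_A :: "config \<Rightarrow> int \<Rightarrow> int" where
  "occ_A \<eta> k = of_bool (\<eta> k = 0)"

definition occ_B :: "config \<Rightarrow> int \<Rightarrow> int" where
  "occ_B \<eta> k = of_bool (\<eta> k = 2)"

text \<open>The coordinate representation of a configuration: the sets \<open>x\<close> and \<open>y\<close> of sites occupied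
  by A-particles and by B-particles, respectively.\<close>

definition A_positions :: "nat \<Rightarrow> config \<Rightarrow> int set" where
  "A_positions L z = {k \<in> sites L. z k = 0}"

definition B_positions :: "nat \<Rightarrow> config \<Rightarrow> int set" where
  "B_positions L z = {k \<in> sites L. z k = 2}"

definition configs_NM :: "nat \<Rightarrow> nat \<Rightarrow> nat \<Rightarrow> config set" where
  "configs_NM L N M =
     {\<eta> \<in> configs L. card (A_positions L \<eta>) = N \<and> card (B_positions L \<eta>) = M}"

definition Q_A :: "nat \<Rightarrow> real \<Rightarrow> int \<Rightarrow> config \<Rightarrow> real" where
  "Q_A L q x \<eta> =
     q powi ((\<Sum>k\<in>{- int L + 1..x - 1}. occ_A \<eta> k) - (\<Sum>k\<in>{x + 1..int L}. occ_A \<eta> k))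
       * of_int (occ_A \<eta> x)"

definition Q_B :: "nat \<Rightarrow> real \<Rightarrow> int \<Rightarrow> config \<Rightarrow> real" where
  "Q_B L q y \<eta> =
     q powi (- (\<Sum>k\<in>{- int L + 1..y - 1}. occ_B \<eta> k) + (\<Sum>k\<in>{y + 1..int L}. occ_B \<eta> k))
       * of_int (occ_B \<eta> y)"

definition Q_config :: "nat \<Rightarrow> real \<Rightarrow> config \<Rightarrow> config \<Rightarrow> real" where
  "Q_config L q z \<eta> = (\<Prod>x\<in>A_positions L z. Q_A L q x \<eta>) * (\<Prod>y\<in>B_positions L z. Q_B L q y \<eta>)"

definition q_num :: "real \<Rightarrow> nat \<Rightarrow> real" where
  "q_num q n =
     (if q = 1 then real n else (q powi int n - q powi (- int n)) / (q - q powi (- 1)))"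

definition q_fact :: "real \<Rightarrow> nat \<Rightarrow> real" where
  "q_fact q n = (\<Prod>k\<in>{1..n}. q_num q k)"

text \<open>Only meaningful for \<open>N + M \<le> 2 * L\<close>, because of the truncated subtraction.\<close>

definition partition_function :: "nat \<Rightarrow> real \<Rightarrow> nat \<Rightarrow> nat \<Rightarrow> real" where
  "partition_function L q N M =
     q_fact q (2 * L) / (q_fact q N * q_fact q M * q_fact q (2 * L - N - M))"

definition weight :: "nat \<Rightarrow> real \<Rightarrow> config \<Rightarrow> real" where
  "weight L q \<eta> =
     q powi ((\<Sum>k\<in>{- int L + 1..int L}. (2 * k - 1) * (occ_A \<eta> k - occ_B \<eta> k))
        + (\<Sum>k\<in>{- int L + 1..int L - 1}. \<Sum>l\<in>{- int L + 1..k}.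
             occ_A \<eta> l * occ_B \<eta> (k + 1) - occ_B \<eta> l * occ_A \<eta> (k + 1)))"

definition stationary :: "nat \<Rightarrow> real \<Rightarrow> nat \<Rightarrow> nat \<Rightarrow> config \<Rightarrow> real" where
  "stationary L q N M \<eta> =
     indicator (configs_NM L N M) \<eta> / partition_function L q N M * weight L q \<eta>"

end

theory Submission
  imports Defs
begin

text \<open>Every exponent in the theorem is built from one antisymmetric biadditive form on finite sets of
  sites, \<open>S(X, Y)\<close>, the sum of \<open>sgn (x - y)\<close> over \<open>x \<in> X\<close> and \<open>y \<in> Y\<close>. Let \<open>A\<close> and \<open>B\<close> be the sets of
  sites occupied by the two species and let \<open>\<Lambda>\<close> be the lattice. Since \<open>2 k - 1\<close> counts the sites to
  the left of \<open>k\<close> minus those to the right, the weight of a configuration is \<open>q\<close> to the power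
  \<open>S(A, \<Lambda>) - S(B, \<Lambda>) + S(B, A)\<close> (lemma \<open>weight_eq_pair_exponent\<close>). Likewise, if \<open>z\<close> has positions
  \<open>(X, Y)\<close> with \<open>X \<subseteq> A\<close> and \<open>Y \<subseteq> B\<close>, then \<open>Q\<^sub>z\<close> is \<open>q\<close> to the power \<open>S(X, A) - S(Y, B)\<close>, and otherwise it
  vanishes (lemma \<open>Q_config_eq\<close>).

  The sum over \<open>z\<close> therefore factorizes into independent sums over the subsets of \<open>A\<close> and of \<open>B\<close>. The
  values \<open>S({x}, A)\<close> for \<open>x \<in> A\<close> form an arithmetic progression with difference \<open>2\<close> centred at \<open>0\<close>,
  whatever the position of \<open>A\<close> in the lattice, so each sum is an elementary symmetric polynomial of
  a geometric progression, that is, a quantum binomial coefficient (lemma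
  \<open>q_subset_sum_eq_q_binomial\<close>). Hence the sum depends only on the particle numbers.

  For the sum over \<open>\<eta>\<close>, write \<open>A = X \<union> D\<close> and \<open>B = Y \<union> E\<close>, where \<open>D\<close> and \<open>E\<close> are disjoint subsets of the
  set \<open>V\<close> of vacancies of \<open>z\<close>. The exponent of \<open>Q\<^sub>z\<close> supplies exactly the cross terms between \<open>(X, Y)\<close>
  and \<open>(D, E)\<close> that replace \<open>\<Lambda>\<close> by \<open>V\<close>: the weight of \<open>\<eta>\<close> times \<open>Q\<^sub>z\<close> is the weight
  of \<open>z\<close> times the weight of \<open>(D, E)\<close> on \<open>V\<close> (lemma \<open>pair_exponent_Un\<close>). Summing over \<open>(D, E)\<close> gives
  the quantum trinomial coefficient of \<open>V\<close> (lemma \<open>sum_pair_exponent_eq_q_trinomial\<close>). Dividing by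
  the partition functions leaves the product of the same two quantum binomial coefficients.\<close>

section \<open>Quantum integers\<close>

text \<open>The Pascal rule for quantum integers. It drives the recursion of the quantum binomial
  coefficients, and with \<open>b = 1\<close> it shows that quantum integers are positive.\<close>

lemma q_num_add:
  assumes "0 < q"
  shows "q_num q (a + b) = q powi (- int b) * q_num q a + q powi int a * q_num q b"
proof (cases "q = 1")
  case False
  have "q powi (int a + int b) - q powi (- int a - int b) =
      q powi (- int b) * (q powi int a - q powi (- int a))
      + q powi int a * (q powi int b - q powi (- int b))"
    using assms by (simp add: power_int_add power_int_diff power_int_minus field_simps)
  with False show ?thesis
    by (simp add: q_num_def add_divide_distrib[symmetric])
qed (simp add: q_num_def)

lemma q_num_1: "0 < q \<Longrightarrow> q_num q 1 = 1"
proof (cases "q = 1")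
  case False
  assume "0 < q"
  have "q \<noteq> inverse q"
  proof
    assume "q = inverse q"
    hence "q\<^sup>2 = 1" using \<open>0 < q\<close> by (metis power2_eq_square right_inverse less_irrefl)
    with \<open>0 < q\<close> False show False by (auto simp: power2_eq_1_iff)
  qed
  with False show ?thesis by (simp add: q_num_def power_int_minus)
qed (simp add: q_num_def)

lemma q_num_Suc_pos: "0 < q \<Longrightarrow> 0 < q_num q (Suc n)"
proof (induction n)
  case (Suc n)
  then show ?case
    using q_num_add[of q "Suc n" 1] by (simp add: q_num_1[simplified] add_pos_pos)
qed (simp add: q_num_1[simplified])

text \<open>The exponents of the B-particles carry the opposite sign, which amounts to replacing \<open>q\<close> by its
  inverse. By this symmetry the sums for both species have the same form.\<close>

lemma q_num_inverse: "q_num (inverse q) n = q_num q n"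
proof -
  have "(x - y) / (u - v) = (y - x) / (v - u)" for x y u v :: real
    by (metis minus_diff_eq minus_divide_divide)
  thus ?thesis
    unfolding q_num_def
    by (simp only: power_int_inverse power_int_minus inverse_inverse_eq inverse_eq_1_iff
        power_int_1_right)
qed

lemma q_fact_0 [simp]: "q_fact q 0 = 1"
  by (simp add: q_fact_def)

lemma q_fact_Suc [simp]: "q_fact q (Suc n) = q_num q (Suc n) * q_fact q n"
  by (simp add: q_fact_def prod.nat_ivl_Suc' mult.commute)

lemma q_fact_pos: "0 < q \<Longrightarrow> 0 < q_fact q n"
  by (induction n) (auto intro!: mult_pos_pos q_num_Suc_pos)

lemma q_fact_inverse: "q_fact (inverse q) n = q_fact q n"
  by (simp add: q_fact_def q_num_inverse)


section \<open>The order balance of two sets\<close>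

text \<open>For \<open>X = {x}\<close>, this is the number of elements of \<open>Y\<close> to the left of \<open>x\<close> minus the number
  of those to the right of \<open>x\<close>.\<close>

definition order_balance :: "int set \<Rightarrow> int set \<Rightarrow> int" where
  "order_balance X Y = (\<Sum>x\<in>X. \<Sum>y\<in>Y. sgn (x - y))"

lemma order_balance_empty [simp]: "order_balance {} Y = 0"
  by (simp add: order_balance_def)

lemma order_balance_antisym: "order_balance Y X = - order_balance X Y"
proof -
  have "order_balance Y X = (\<Sum>x\<in>X. \<Sum>y\<in>Y. sgn (y - x))"
    unfolding order_balance_def by (rule sum.swap)
  also have "\<dots> = (\<Sum>x\<in>X. \<Sum>y\<in>Y. - sgn (x - y))"
    by (intro sum.cong refl) (simp add: sgn_if)
  finally show ?thesis by (simp add: order_balance_def sum_negf)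
qed

lemma order_balance_self [simp]: "order_balance X X = 0"
  using order_balance_antisym[of X X] by simp

lemma order_balance_Un_left:
  assumes "finite X" "finite X'" "X \<inter> X' = {}"
  shows "order_balance (X \<union> X') Y = order_balance X Y + order_balance X' Y"
  using assms by (simp add: order_balance_def sum.union_disjoint)

lemma order_balance_Un_right:
  assumes "finite Y" "finite Y'" "Y \<inter> Y' = {}"
  shows "order_balance X (Y \<union> Y') = order_balance X Y + order_balance X Y'"
  using assms by (simp add: order_balance_def sum.union_disjoint sum.distrib)

lemma order_balance_Diff_right:
  assumes "finite V" "Y \<subseteq> V"
  shows "order_balance X (V - Y) = order_balance X V - order_balance X Y"
  using assms
  by (simp add: order_balance_def sum_diff finite_subset sum_subtractf)

lemma order_balance_below_insert:
  assumes "finite V" "\<forall>v\<in>V. v < b" "X \<subseteq> V"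
  shows "order_balance X (insert b V) = order_balance X V - int (card X)"
proof -
  have "b \<notin> V" using assms by auto
  hence "order_balance X (insert b V) = (\<Sum>x\<in>X. - 1 + (\<Sum>y\<in>V. sgn (x - y)))"
    unfolding order_balance_def using assms by (intro sum.cong refl) (auto simp: subset_iff)
  thus ?thesis by (simp add: order_balance_def sum_subtractf)
qed

lemma order_balance_insert_max:
  assumes "finite V" "\<forall>v\<in>V. v < b" "D \<subseteq> V"
  shows "order_balance (insert b D) (insert b V)
      = order_balance D V - int (card D) + int (card V)"
proof -
  have "b \<notin> D" "b \<notin> V" "finite D" using assms by (auto intro: finite_subset)
  hence "order_balance (insert b D) (insert b V)
      = (\<Sum>y\<in>V. sgn (b - y)) + order_balance D (insert b V)"
    using assms by (simp add: order_balance_def)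
  also have "(\<Sum>y\<in>V. sgn (b - y)) = (\<Sum>y\<in>V. 1)"
    using assms by (intro sum.cong) auto
  finally show ?thesis
    using assms order_balance_below_insert[of V b D] by auto
qed


section \<open>The quantum binomial theorem for subsets\<close>

definition ksubsets :: "'a set \<Rightarrow> nat \<Rightarrow> 'a set set" where
  "ksubsets V n = {D. D \<subseteq> V \<and> card D = n}"

lemma finite_ksubsets: "finite V \<Longrightarrow> finite (ksubsets V n)"
  by (simp add: ksubsets_def)

lemma ksubsets_0: "finite V \<Longrightarrow> ksubsets V 0 = {{}}"
  by (auto simp: ksubsets_def intro: finite_subset dest: finite_subset)

lemma ksubsets_empty: "finite V \<Longrightarrow> card V < n \<Longrightarrow> ksubsets V n = {}"
  by (auto simp: ksubsets_def dest: card_mono)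

lemma ksubsets_insert_Suc:
  assumes "finite V" "b \<notin> V"
  shows "ksubsets (insert b V) (Suc n) = ksubsets V (Suc n) \<union> insert b ` ksubsets V n"
proof (intro equalityI subsetI)
  fix D assume D: "D \<in> ksubsets (insert b V) (Suc n)"
  hence fin: "finite D" using assms by (auto simp: ksubsets_def dest: finite_subset)
  show "D \<in> ksubsets V (Suc n) \<union> insert b ` ksubsets V n"
  proof (cases "b \<in> D")
    case True
    hence "D = insert b (D - {b})" "D - {b} \<in> ksubsets V n"
      using D fin by (auto simp: ksubsets_def)
    thus ?thesis by blast
  qed (use D in \<open>auto simp: ksubsets_def\<close>)
next
  fix D assume "D \<in> ksubsets V (Suc n) \<union> insert b ` ksubsets V n"
  moreover have "finite X" "b \<notin> X" if "X \<subseteq> V" for X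
    using assms that by (auto intro: finite_subset)
  ultimately show "D \<in> ksubsets (insert b V) (Suc n)"
    by (auto simp: ksubsets_def)
qed

text \<open>If \<open>V\<close> has \<open>m\<close> elements, its \<open>j\<close>-th smallest one contributes \<open>2 j - m - 1\<close> to the exponent. The sum
  is thus the elementary symmetric polynomial of degree \<open>n\<close> in the numbers \<open>q powi (2 j - m - 1)\<close>.\<close>

definition q_subset_sum :: "real \<Rightarrow> int set \<Rightarrow> nat \<Rightarrow> real" where
  "q_subset_sum q V n = (\<Sum>D\<in>ksubsets V n. q powi order_balance D V)"

lemma q_subset_sum_empty: "finite V \<Longrightarrow> card V < n \<Longrightarrow> q_subset_sum q V n = 0"
  by (simp add: q_subset_sum_def ksubsets_empty)

text \<open>A subset of the enlarged set either avoids the new maximum \<open>b\<close>, and then each of its \<open>Suc n\<close>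
  elements sees one more site to its right, or it contains \<open>b\<close>, which sees all \<open>card V\<close> other
  elements to its left, while the remaining \<open>n\<close> elements see \<open>b\<close> to their right.\<close>

lemma q_subset_sum_insert_max:
  assumes "finite V" "\<forall>v\<in>V. v < b" "0 < q"
  shows "q_subset_sum q (insert b V) (Suc n) =
      q powi (- int (Suc n)) * q_subset_sum q V (Suc n)
      + q powi (int (card V) - int n) * q_subset_sum q V n"
proof -
  have b: "b \<notin> V" and nz: "q \<noteq> 0" using assms by auto
  have inj: "inj_on (insert b) (ksubsets V n)"
    using b by (force simp: inj_on_def ksubsets_def)
  have "q_subset_sum q (insert b V) (Suc n) =
      (\<Sum>D\<in>ksubsets V (Suc n). q powi order_balance D (insert b V))
      + (\<Sum>D\<in>ksubsets V n. q powi order_balance (insert b D) (insert b V))"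
    unfolding q_subset_sum_def ksubsets_insert_Suc[OF assms(1) b]
    by (subst sum.union_disjoint)
      (use b assms inj in \<open>auto simp: finite_ksubsets ksubsets_def sum.reindex\<close>)
  also have "(\<Sum>D\<in>ksubsets V (Suc n). q powi order_balance D (insert b V)) =
      q powi (- int (Suc n)) * q_subset_sum q V (Suc n)"
    unfolding q_subset_sum_def sum_distrib_left
  proof (intro sum.cong refl)
    fix D assume "D \<in> ksubsets V (Suc n)"
    hence "order_balance D (insert b V) = - int (Suc n) + order_balance D V"
      using assms order_balance_below_insert[of V b D] by (auto simp: ksubsets_def)
    thus "q powi order_balance D (insert b V) =
        q powi (- int (Suc n)) * q powi order_balance D V"
      by (simp only: power_int_add nz simp_thms)
  qed
  also have "(\<Sum>D\<in>ksubsets V n. q powi order_balance (insert b D) (insert b V)) =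
      q powi (int (card V) - int n) * q_subset_sum q V n"
    unfolding q_subset_sum_def sum_distrib_left
  proof (intro sum.cong refl)
    fix D assume "D \<in> ksubsets V n"
    hence "order_balance (insert b D) (insert b V) =
        (int (card V) - int n) + order_balance D V"
      using assms order_balance_insert_max[of V b D] by (auto simp: ksubsets_def)
    thus "q powi order_balance (insert b D) (insert b V) =
        q powi (int (card V) - int n) * q powi order_balance D V"
      by (simp only: power_int_add nz simp_thms)
  qed
  finally show ?thesis .
qed

text \<open>Removing the maximum of \<open>V\<close> turns the claim into the Pascal rule \<open>q_num_add\<close>.
  The result depends on \<open>V\<close> only through its cardinality, which is what makes the sum rule
  independent of the configuration.\<close>

lemma q_subset_sum_eq_q_binomial:
  assumes "finite V" "0 < q" "n \<le> card V"
  shows "q_subset_sum q V n = q_fact q (card V) / (q_fact q n * q_fact q (card V - n))"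
  using assms(1,3)
proof (induction V arbitrary: n rule: finite_linorder_max_induct)
  case empty
  then show ?case by (simp add: q_subset_sum_def ksubsets_0)
next
  case (insert b V)
  have b: "b \<notin> V" using insert by auto
  note pos = q_fact_pos[OF assms(2)] q_num_Suc_pos[OF assms(2)]
  show ?case
  proof (cases n)
    case 0
    have "q_fact q (card (insert b V)) \<noteq> 0" using pos(1) by (metis less_irrefl)
    with 0 insert show ?thesis by (simp add: q_subset_sum_def ksubsets_0)
  next
    case (Suc k)
    with insert b have k: "k \<le> card V" by simp
    define a where "a = card V - k"
    have V: "card V = a + k" using k by (simp add: a_def)
    have *: "q_subset_sum q V k = q_fact q (card V) / (q_fact q k * q_fact q a)"
      using insert.IH[OF k] by (simp add: a_def)
    \<comment> \<open>Writing the value with the factor \<open>q_num q a\<close> also covers \<open>a = 0\<close>, where both sides vanish.\<close>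
    have **: "q_subset_sum q V (Suc k) =
        q_num q a * q_fact q (card V) / (q_fact q (Suc k) * q_fact q a)"
    proof (cases a)
      case 0
      have "q_num q 0 = 0" by (simp add: q_num_def)
      with 0 V insert.hyps show ?thesis by (simp add: q_subset_sum_empty)
    next
      case (Suc a')
      have "q_subset_sum q V (Suc k) = q_fact q (card V) / (q_fact q (Suc k) * q_fact q a')"
        using insert.IH[of "Suc k"] V Suc by simp
      thus ?thesis using Suc pos(2)[of a'] by simp
    qed
    have "q_subset_sum q (insert b V) n =
        (q powi (- int (Suc k)) * q_num q a + q powi int a * q_num q (Suc k))
        * q_fact q (card V) / (q_fact q (Suc k) * q_fact q a)"
      unfolding Suc q_subset_sum_insert_max[OF insert.hyps assms(2)] * **
      using pos(1)[of a] pos(1)[of k] pos(2)[of k] V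
      by (simp add: field_simps)
    also have "\<dots> = q_num q (a + Suc k) * q_fact q (card V) / (q_fact q (Suc k) * q_fact q a)"
      by (simp only: q_num_add[OF assms(2)])
    finally show ?thesis
      using insert.hyps b Suc V by simp
  qed
qed


section \<open>Pairs of disjoint sets and the quantum trinomial coefficient\<close>

definition disjoint_pairs :: "'a set \<Rightarrow> nat \<Rightarrow> nat \<Rightarrow> ('a set \<times> 'a set) set" where
  "disjoint_pairs V n m = (SIGMA D : ksubsets V n. ksubsets (V - D) m)"

lemma mem_disjoint_pairs:
  "(D, E) \<in> disjoint_pairs V n m \<longleftrightarrow>
     D \<subseteq> V \<and> E \<subseteq> V \<and> D \<inter> E = {} \<and> card D = n \<and> card E = m"
  by (auto simp: disjoint_pairs_def ksubsets_def)

lemma finite_disjoint_pairs: "finite V \<Longrightarrow> finite (disjoint_pairs V n m)"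
  by (simp add: disjoint_pairs_def finite_ksubsets)

text \<open>With \<open>V\<close> the whole lattice, this is the exponent of the stationary weight of the configuration
  with A-particles on \<open>D\<close> and B-particles on \<open>E\<close>.\<close>

definition pair_exponent :: "int set \<Rightarrow> int set \<Rightarrow> int set \<Rightarrow> int" where
  "pair_exponent V D E = order_balance D V - order_balance E V + order_balance E D"

text \<open>For fixed \<open>D\<close>, the interaction of \<open>E\<close> with \<open>D\<close> has the effect of deleting \<open>D\<close> from the set \<open>V\<close>
  against which \<open>E\<close> is balanced. The sum over \<open>E\<close> is then a quantum binomial coefficient of \<open>V - D\<close>,
  whose value is the same for all \<open>D\<close>, and the sum over \<open>D\<close> gives a second such coefficient.\<close>

lemma sum_pair_exponent_eq_q_trinomial:
  assumes "finite V" "0 < q" "n + m \<le> card V"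
  shows "(\<Sum>(D, E)\<in>disjoint_pairs V n m. q powi pair_exponent V D E) =
      q_fact q (card V) / (q_fact q n * q_fact q m * q_fact q (card V - n - m))"
proof -
  have inner: "(\<Sum>E\<in>ksubsets (V - D) m. q powi pair_exponent V D E) =
      q powi order_balance D V * (q_fact q (card V - n) / (q_fact q m * q_fact q (card V - n - m)))"
    if "D \<in> ksubsets V n" for D
  proof -
    have D: "D \<subseteq> V" "card D = n" "finite D"
      using that assms by (auto simp: ksubsets_def dest: finite_subset)
    have card: "card (V - D) = card V - n" using D by (simp add: card_Diff_subset)
    have "(\<Sum>E\<in>ksubsets (V - D) m. q powi pair_exponent V D E) =
        q powi order_balance D V * q_subset_sum (inverse q) (V - D) m"
      unfolding q_subset_sum_def sum_distrib_left
    proof (intro sum.cong refl)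
      fix E
      have "pair_exponent V D E = order_balance D V + - order_balance E (V - D)"
        using assms D by (simp add: pair_exponent_def order_balance_Diff_right)
      thus "q powi pair_exponent V D E =
          q powi order_balance D V * inverse q powi order_balance E (V - D)"
        using assms by (simp add: power_int_diff power_int_inverse divide_inverse)
    qed
    also have "q_subset_sum (inverse q) (V - D) m =
        q_fact q (card V - n) / (q_fact q m * q_fact q (card V - n - m))"
      using assms card
      by (subst q_subset_sum_eq_q_binomial) (simp_all add: q_fact_inverse)
    finally show ?thesis .
  qed
  have "(\<Sum>(D, E)\<in>disjoint_pairs V n m. q powi pair_exponent V D E) =
      (\<Sum>D\<in>ksubsets V n. \<Sum>E\<in>ksubsets (V - D) m. q powi pair_exponent V D E)"
    unfolding disjoint_pairs_def using assms by (subst sum.Sigma) (auto simp: finite_ksubsets)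
  also have "\<dots> = q_subset_sum q V n
      * (q_fact q (card V - n) / (q_fact q m * q_fact q (card V - n - m)))"
    unfolding q_subset_sum_def sum_distrib_right by (intro sum.cong refl inner)
  also have "\<dots> = q_fact q (card V) / (q_fact q n * q_fact q m * q_fact q (card V - n - m))"
    using assms q_fact_pos[OF assms(2), of "card V - n"]
    by (simp add: q_subset_sum_eq_q_binomial)
  finally show ?thesis .
qed

text \<open>The key identity. Each new particle on a vacancy feels the old particles through the one-body
  terms on \<open>U\<close>, through its interaction with the other species, and through the duality exponents
  of its own species. These contributions combine so that both old species are removed from \<open>U\<close>:
  what remains is the exponent of \<open>(D, E)\<close> on the vacancies alone.\<close>

lemma pair_exponent_Un:
  assumes "finite U" "A \<subseteq> U" "B \<subseteq> U" "A \<inter> B = {}"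
    and "D \<subseteq> U - A - B" "E \<subseteq> U - A - B"
  shows "pair_exponent U (A \<union> D) (B \<union> E) + order_balance A (A \<union> D) - order_balance B (B \<union> E)
      = pair_exponent U A B + pair_exponent (U - A - B) D E"
proof -
  have fin: "finite A" "finite B" "finite D" "finite E"
    using assms by (auto intro: finite_subset)
  have disj: "A \<inter> D = {}" "B \<inter> E = {}" using assms by auto
  have "order_balance X (U - A - B) = order_balance X U - order_balance X A - order_balance X B" for X
    using assms by (subst order_balance_Diff_right) (auto simp: order_balance_Diff_right)
  thus ?thesis
    using order_balance_antisym[of A D] order_balance_antisym[of B E] order_balance_antisym[of B D]
      order_balance_antisym[of A E]
    by (simp add: pair_exponent_def order_balance_Un_left order_balance_Un_right fin disj)
qed

lemma sum_over_extensions: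
  fixes g :: "'a set \<times> 'a set \<Rightarrow> 'b::comm_monoid_add"
  assumes "finite U" "A \<subseteq> U" "B \<subseteq> U" "A \<inter> B = {}" "card A \<le> n" "card B \<le> m"
  shows "(\<Sum>(X, Y)\<in>disjoint_pairs U n m. if A \<subseteq> X \<and> B \<subseteq> Y then g (X, Y) else 0) =
      (\<Sum>(D, E)\<in>disjoint_pairs (U - A - B) (n - card A) (m - card B). g (A \<union> D, B \<union> E))"
proof -
  let ?S = "{(X, Y)\<in>disjoint_pairs U n m. A \<subseteq> X \<and> B \<subseteq> Y}"
  have fin: "finite X" if "X \<subseteq> U" for X using that assms(1) by (rule finite_subset)
  have "(\<Sum>(X, Y)\<in>disjoint_pairs U n m. if A \<subseteq> X \<and> B \<subseteq> Y then g (X, Y) else 0) = (\<Sum>p\<in>?S. g p)"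
    using assms(1) by (intro sum.mono_neutral_cong_right) (auto simp: finite_disjoint_pairs split: if_splits)
  also have "\<dots> = (\<Sum>(D, E)\<in>disjoint_pairs (U - A - B) (n - card A) (m - card B). g (A \<union> D, B \<union> E))"
  proof (rule sum.reindex_bij_witness[where i = "\<lambda>(D, E). (A \<union> D, B \<union> E)"
        and j = "\<lambda>(X, Y). (X - A, Y - B)"])
    fix p assume "p \<in> disjoint_pairs (U - A - B) (n - card A) (m - card B)"
    then obtain D E where p: "p = (D, E)" and DE: "D \<subseteq> U - A - B" "E \<subseteq> U - A - B" "D \<inter> E = {}"
      "card D = n - card A" "card E = m - card B"
      by (cases p) (auto simp: mem_disjoint_pairs)
    have "finite D" "finite E" using DE by (auto intro!: fin)
    hence "card (A \<union> D) = n" "card (B \<union> E) = m"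
      using assms DE fin[of A] fin[of B]
      by (subst card_Un_disjoint; auto)+
    thus "(case p of (D, E) \<Rightarrow> (A \<union> D, B \<union> E)) \<in> ?S"
      using assms DE p by (auto simp: mem_disjoint_pairs)
    show "(case case p of (D, E) \<Rightarrow> (A \<union> D, B \<union> E) of (X, Y) \<Rightarrow> (X - A, Y - B)) = p"
      using DE p by auto
  next
    fix p assume "p \<in> ?S"
    then obtain X Y where p: "p = (X, Y)" and XY: "X \<subseteq> U" "Y \<subseteq> U" "X \<inter> Y = {}"
      "card X = n" "card Y = m" "A \<subseteq> X" "B \<subseteq> Y"
      by (cases p) (auto simp: mem_disjoint_pairs)
    show "(case p of (X, Y) \<Rightarrow> (X - A, Y - B))
        \<in> disjoint_pairs (U - A - B) (n - card A) (m - card B)"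
      using p XY assms fin[of A] fin[of B] by (auto simp: mem_disjoint_pairs card_Diff_subset)
    show "(case case p of (X, Y) \<Rightarrow> (X - A, Y - B) of (D, E) \<Rightarrow> (A \<union> D, B \<union> E)) = p"
      using p XY by auto
    show "(case case p of (X, Y) \<Rightarrow> (X - A, Y - B) of (D, E) \<Rightarrow> g (A \<union> D, B \<union> E)) = g p"
      using p XY by (auto simp: Un_absorb1)
  qed
  finally show ?thesis .
qed


section \<open>Configurations in coordinates\<close>

lemma finite_sites: "finite (sites L)" and card_sites: "card (sites L) = 2 * L"
  by (simp_all add: sites_def)

lemma positions_in_disjoint_pairs:
  assumes "\<eta> \<in> configs_NM L N M"
  shows "(A_positions L \<eta>, B_positions L \<eta>) \<in> disjoint_pairs (sites L) N M"
  using assms by (auto simp: mem_disjoint_pairs configs_NM_def A_positions_def B_positions_def)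

text \<open>A configuration is determined by its particle positions, so sums over configurations become
  sums over pairs of disjoint sets.\<close>

lemma sum_configs_NM:
  "(\<Sum>\<eta>\<in>configs_NM L N M. f (A_positions L \<eta>) (B_positions L \<eta>)) =
   (\<Sum>(A, B)\<in>disjoint_pairs (sites L) N M. f A B)"
proof (rule sum.reindex_bij_witness[where j = "\<lambda>\<eta>. (A_positions L \<eta>, B_positions L \<eta>)"
      and i = "\<lambda>(A, B) k. if k \<in> sites L then if k \<in> A then 0 else if k \<in> B then 2 else 1
        else undefined"])
  fix \<eta> assume \<eta>: "\<eta> \<in> configs_NM L N M"
  hence "\<eta> \<in> sites L \<rightarrow>\<^sub>E {0, 1, 2}" by (simp add: configs_NM_def configs_def)
  thus "(case (A_positions L \<eta>, B_positions L \<eta>) of (A, B) \<Rightarrow>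
      \<lambda>k. if k \<in> sites L then if k \<in> A then 0 else if k \<in> B then 2 else 1 else undefined) = \<eta>"
    by (auto simp: fun_eq_iff A_positions_def B_positions_def PiE_iff extensional_def)
  show "(A_positions L \<eta>, B_positions L \<eta>) \<in> disjoint_pairs (sites L) N M"
    by (rule positions_in_disjoint_pairs[OF \<eta>])
next
  fix p assume "p \<in> disjoint_pairs (sites L) N M"
  then obtain A B where p: "p = (A, B)" and AB: "A \<subseteq> sites L" "B \<subseteq> sites L" "A \<inter> B = {}"
    "card A = N" "card B = M"
    by (cases p) (auto simp: mem_disjoint_pairs)
  let ?\<eta> = "case p of (A, B) \<Rightarrow> \<lambda>k. if k \<in> sites L then if k \<in> A then 0::nat
    else if k \<in> B then 2 else 1 else undefined"
  have pos: "A_positions L ?\<eta> = A" "B_positions L ?\<eta> = B"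
    using p AB by (auto simp: A_positions_def B_positions_def split: if_splits)
  thus "(A_positions L ?\<eta>, B_positions L ?\<eta>) = p" using p by simp
  have "?\<eta> \<in> configs L" using p by (auto simp: configs_def split: if_splits)
  thus "?\<eta> \<in> configs_NM L N M" using pos AB by (simp add: configs_NM_def)
qed auto

text \<open>The exponents of \<open>Q_A\<close> and \<open>Q_B\<close> have this form, and with \<open>f = 1\<close> the one-body term \<open>2 k - 1\<close> of the
  weight has it as well.\<close>

lemma left_right_difference:
  fixes f :: "int \<Rightarrow> int"
  assumes "x \<in> sites L"
  shows "(\<Sum>k\<in>{- int L + 1..x - 1}. f k) - (\<Sum>k\<in>{x + 1..int L}. f k) =
      (\<Sum>k\<in>sites L. sgn (x - k) * f k)"
proof -
  have "sites L = {- int L + 1..x - 1} \<union> {x} \<union> {x + 1..int L}"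
    using assms by (auto simp: sites_def)
  hence "(\<Sum>k\<in>sites L. sgn (x - k) * f k) =
      (\<Sum>k\<in>{- int L + 1..x - 1}. sgn (x - k) * f k) + (\<Sum>k\<in>{x + 1..int L}. sgn (x - k) * f k)"
    by (simp add: sum.union_disjoint)
  also have "(\<Sum>k\<in>{- int L + 1..x - 1}. sgn (x - k) * f k) = (\<Sum>k\<in>{- int L + 1..x - 1}. f k)"
    by (intro sum.cong) auto
  also have "(\<Sum>k\<in>{x + 1..int L}. sgn (x - k) * f k) = (\<Sum>k\<in>{x + 1..int L}. - f k)"
    by (intro sum.cong) auto
  finally show ?thesis by (simp add: sum_negf)
qed

lemma sum_sgn_sites:
  assumes "k \<in> sites L"
  shows "(\<Sum>u\<in>sites L. sgn (k - u)) = 2 * k - 1"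
  using left_right_difference[OF assms, of "\<lambda>_. 1"] assms by (simp add: sites_def)

lemma sum_occ_A: "(\<Sum>k\<in>sites L. f k * occ_A \<eta> k) = sum f (A_positions L \<eta>)"
  and sum_occ_B: "(\<Sum>k\<in>sites L. f k * occ_B \<eta> k) = sum f (B_positions L \<eta>)"
  unfolding occ_A_def occ_B_def A_positions_def B_positions_def
  by (rule sum.mono_neutral_cong_right; auto simp: finite_sites)+

text \<open>The index shift \<open>k + 1\<close> in the interaction term of the weight turns \<open>l \<le> k\<close> into \<open>l < k\<close>; the
  leftmost site, which the shifted range omits, has no site to its left.\<close>

lemma sum_left_of_site:
  fixes F :: "int \<Rightarrow> int \<Rightarrow> int"
  shows "(\<Sum>k\<in>{- int L + 1..int L - 1}. \<Sum>l\<in>{- int L + 1..k}. F l (k + 1)) =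
      (\<Sum>k\<in>sites L. \<Sum>l\<in>sites L. of_bool (l < k) * F l k)"
proof -
  have "(\<Sum>k\<in>{- int L + 1..int L - 1}. \<Sum>l\<in>{- int L + 1..k}. F l (k + 1)) =
      (\<Sum>k\<in>{- int L + 2..int L}. \<Sum>l\<in>{- int L + 1..k - 1}. F l k)"
    by (rule sum.reindex_bij_witness[where i = "\<lambda>k. k - 1" and j = "\<lambda>k. k + 1"]) auto
  also have "\<dots> = (\<Sum>k\<in>sites L. \<Sum>l\<in>{- int L + 1..k - 1}. F l k)"
    by (rule sum.mono_neutral_left) (auto simp: sites_def)
  also have "\<dots> = (\<Sum>k\<in>sites L. \<Sum>l\<in>sites L. of_bool (l < k) * F l k)"
    by (intro sum.cong refl sum.mono_neutral_cong_left) (auto simp: sites_def)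
  finally show ?thesis .
qed

lemma sum_interaction:
  "(\<Sum>k\<in>{- int L + 1..int L - 1}. \<Sum>l\<in>{- int L + 1..k}.
      occ_A \<eta> l * occ_B \<eta> (k + 1) - occ_B \<eta> l * occ_A \<eta> (k + 1))
    = order_balance (B_positions L \<eta>) (A_positions L \<eta>)"
proof -
  have "(\<Sum>k\<in>{- int L + 1..int L - 1}. \<Sum>l\<in>{- int L + 1..k}.
      occ_A \<eta> l * occ_B \<eta> (k + 1) - occ_B \<eta> l * occ_A \<eta> (k + 1)) =
      (\<Sum>k\<in>sites L. \<Sum>l\<in>sites L. of_bool (l < k) * (occ_A \<eta> l * occ_B \<eta> k))
      - (\<Sum>k\<in>sites L. \<Sum>l\<in>sites L. of_bool (l < k) * (occ_B \<eta> l * occ_A \<eta> k))"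
    by (subst sum_left_of_site) (simp add: right_diff_distrib sum_subtractf)
  \<comment> \<open>Renaming the two sites in the BA-term makes both terms sums of the same products.\<close>
  also have "(\<Sum>k\<in>sites L. \<Sum>l\<in>sites L. of_bool (l < k) * (occ_B \<eta> l * occ_A \<eta> k)) =
      (\<Sum>k\<in>sites L. \<Sum>l\<in>sites L. of_bool (k < l) * (occ_B \<eta> k * occ_A \<eta> l))"
    by (rule sum.swap)
  also have "(\<Sum>k\<in>sites L. \<Sum>l\<in>sites L. of_bool (l < k) * (occ_A \<eta> l * occ_B \<eta> k)) - \<dots> =
      (\<Sum>k\<in>sites L. (\<Sum>l\<in>sites L. sgn (k - l) * occ_A \<eta> l) * occ_B \<eta> k)"
    unfolding sum_subtractf[symmetric] sum_distrib_right
    by (intro sum.cong refl) auto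
  finally show ?thesis by (simp add: sum_occ_A sum_occ_B order_balance_def)
qed

lemma weight_eq_pair_exponent:
  "weight L q \<eta> = q powi pair_exponent (sites L) (A_positions L \<eta>) (B_positions L \<eta>)"
proof -
  have "(\<Sum>k\<in>sites L. (2 * k - 1) * (occ_A \<eta> k - occ_B \<eta> k)) =
      sum (\<lambda>k. 2 * k - 1) (A_positions L \<eta>) - sum (\<lambda>k. 2 * k - 1) (B_positions L \<eta>)"
    by (simp only: right_diff_distrib sum_subtractf sum_occ_A sum_occ_B)
  also have "sum (\<lambda>k. 2 * k - 1) (A_positions L \<eta>) = order_balance (A_positions L \<eta>) (sites L)"
    unfolding order_balance_def
    by (intro sum.cong refl sum_sgn_sites[symmetric])
      (simp add: A_positions_def)
  also have "sum (\<lambda>k. 2 * k - 1) (B_positions L \<eta>) = order_balance (B_positions L \<eta>) (sites L)"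
    unfolding order_balance_def
    by (intro sum.cong refl sum_sgn_sites[symmetric])
      (simp add: B_positions_def)
  finally show ?thesis
    unfolding weight_def sum_interaction pair_exponent_def by (simp add: sites_def)
qed

lemma Q_A_eq:
  assumes "x \<in> sites L"
  shows "Q_A L q x \<eta> = (if x \<in> A_positions L \<eta>
      then q powi (\<Sum>k\<in>A_positions L \<eta>. sgn (x - k)) else 0)"
proof -
  have "(\<Sum>k\<in>{- int L + 1..x - 1}. occ_A \<eta> k) - (\<Sum>k\<in>{x + 1..int L}. occ_A \<eta> k) =
      (\<Sum>k\<in>A_positions L \<eta>. sgn (x - k))"
    using left_right_difference[OF assms, of "occ_A \<eta>"] by (simp add: sum_occ_A)
  with assms show ?thesis unfolding Q_A_def by (simp add: A_positions_def occ_A_def)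
qed

lemma Q_B_eq:
  assumes "y \<in> sites L"
  shows "Q_B L q y \<eta> = (if y \<in> B_positions L \<eta>
      then q powi (- (\<Sum>k\<in>B_positions L \<eta>. sgn (y - k))) else 0)"
proof -
  have "- (\<Sum>k\<in>{- int L + 1..y - 1}. occ_B \<eta> k) + (\<Sum>k\<in>{y + 1..int L}. occ_B \<eta> k) =
      - (\<Sum>k\<in>B_positions L \<eta>. sgn (y - k))"
    using left_right_difference[OF assms, of "occ_B \<eta>"] by (simp add: sum_occ_B)
  with assms show ?thesis unfolding Q_B_def by (simp add: B_positions_def occ_B_def)
qed

lemma prod_if_powi:
  fixes q :: "'b::field"
  assumes "finite X" "q \<noteq> 0"
  shows "(\<Prod>x\<in>X. if x \<in> Y then q powi f x else 0) = (if X \<subseteq> Y then q powi (\<Sum>x\<in>X. f x) else 0)"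
  using assms(1)
  by (induction X rule: finite_induct) (use assms(2) in \<open>auto simp: power_int_add\<close>)

text \<open>The exponent of each local factor is the balance of one particle of \<open>z\<close> against all particles of
  its species in \<open>\<eta>\<close>, and the indicator in the factor demands that this particle sits on one of
  them; multiplying the factors adds the balances and collects the indicators.\<close>

lemma Q_config_eq:
  assumes "0 < q"
  shows "Q_config L q z \<eta> =
      (if A_positions L z \<subseteq> A_positions L \<eta> \<and> B_positions L z \<subseteq> B_positions L \<eta>
       then q powi (order_balance (A_positions L z) (A_positions L \<eta>)
                    - order_balance (B_positions L z) (B_positions L \<eta>))
       else 0)"
proof -
  have sub: "A_positions L z \<subseteq> sites L" "B_positions L z \<subseteq> sites L"
    by (auto simp: A_positions_def B_positions_def)
  hence fin: "finite (A_positions L z)" "finite (B_positions L z)"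
    by (auto intro: finite_subset finite_sites)
  have "Q_config L q z \<eta> =
      (\<Prod>x\<in>A_positions L z. if x \<in> A_positions L \<eta>
         then q powi (\<Sum>k\<in>A_positions L \<eta>. sgn (x - k)) else 0)
      * (\<Prod>y\<in>B_positions L z. if y \<in> B_positions L \<eta>
         then q powi (- (\<Sum>k\<in>B_positions L \<eta>. sgn (y - k))) else 0)"
    unfolding Q_config_def using sub
    by (intro arg_cong2[of _ _ _ _ "(*)"] prod.cong refl Q_A_eq Q_B_eq) auto
  thus ?thesis
    using assms fin
    by (simp add: prod_if_powi order_balance_def sum_negf power_int_diff power_int_minus
        divide_inverse)
qed


section \<open>The two sums\<close>

text \<open>Only the configurations \<open>z\<close> whose particles form subsets of those of \<open>\<eta>\<close> contribute, and these
  subsets can be chosen independently because the two species of \<open>\<eta>\<close> are disjoint.\<close>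

lemma sum_Q_config_over_z:
  assumes "0 < q" and \<eta>: "\<eta> \<in> configs_NM L N M"
  shows "(\<Sum>z\<in>configs_NM L N' M'. Q_config L q z \<eta>) =
      q_subset_sum q (A_positions L \<eta>) N' * q_subset_sum (inverse q) (B_positions L \<eta>) M'"
proof -
  define A B where AB: "A = A_positions L \<eta>" "B = B_positions L \<eta>"
  have sub: "A \<subseteq> sites L" "B \<subseteq> sites L" "A \<inter> B = {}"
    using positions_in_disjoint_pairs[OF \<eta>] by (auto simp: AB mem_disjoint_pairs)
  have "(\<Sum>z\<in>configs_NM L N' M'. Q_config L q z \<eta>) =
      (\<Sum>(X, Y)\<in>disjoint_pairs (sites L) N' M'. if X \<subseteq> A \<and> Y \<subseteq> B
         then q powi (order_balance X A - order_balance Y B) else 0)"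
    unfolding Q_config_eq[OF assms(1)] AB by (rule sum_configs_NM)
  also have "\<dots> = (\<Sum>(X, Y)\<in>ksubsets A N' \<times> ksubsets B M'.
      q powi (order_balance X A) * inverse q powi (order_balance Y B))"
  proof (rule sum.mono_neutral_cong_right)
    show "finite (disjoint_pairs (sites L) N' M')"
      by (intro finite_disjoint_pairs finite_sites)
    show "ksubsets A N' \<times> ksubsets B M' \<subseteq> disjoint_pairs (sites L) N' M'"
    proof clarify
      fix X Y assume "X \<in> ksubsets A N'" "Y \<in> ksubsets B M'"
      thus "(X, Y) \<in> disjoint_pairs (sites L) N' M'"
        using sub unfolding mem_disjoint_pairs ksubsets_def by blast
    qed
    show "\<forall>p\<in>disjoint_pairs (sites L) N' M' - ksubsets A N' \<times> ksubsets B M'.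
        (case p of (X, Y) \<Rightarrow> if X \<subseteq> A \<and> Y \<subseteq> B
           then q powi (order_balance X A - order_balance Y B) else 0) = 0"
      by (auto simp: mem_disjoint_pairs ksubsets_def split: if_splits)
    fix p assume "p \<in> ksubsets A N' \<times> ksubsets B M'"
    moreover have "q powi (i - j) = q powi i * inverse q powi j" for i j
      using assms(1) by (simp add: power_int_diff power_int_inverse divide_inverse)
    ultimately show "(case p of (X, Y) \<Rightarrow> if X \<subseteq> A \<and> Y \<subseteq> B
          then q powi (order_balance X A - order_balance Y B) else 0) =
        (case p of (X, Y) \<Rightarrow> q powi (order_balance X A) * inverse q powi (order_balance Y B))"
      by (cases p) (simp add: ksubsets_def)
  qed
  also have "\<dots> = q_subset_sum q A N' * q_subset_sum (inverse q) B M'"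
    by (simp add: q_subset_sum_def sum_product sum.cartesian_product)
  finally show ?thesis by (simp add: AB)
qed

text \<open>The configurations that contribute are obtained from \<open>z\<close> by adding \<open>N - N'\<close> and \<open>M - M'\<close> particles
  on its vacancies. By \<open>pair_exponent_Un\<close>, the weight of \<open>z\<close> splits off, and the remaining sum lives
  on the vacancies.\<close>

lemma sum_weight_Q_config:
  assumes "0 < q" and z: "z \<in> configs_NM L N' M'"
    and "N' \<le> N" "M' \<le> M" "N + M \<le> 2 * L"
  shows "(\<Sum>\<eta>\<in>configs_NM L N M. weight L q \<eta> * Q_config L q z \<eta>) =
      weight L q z * (q_fact q (2 * L - N' - M')
        / (q_fact q (N - N') * q_fact q (M - M') * q_fact q (2 * L - N - M)))"
proof -
  define A B where AB: "A = A_positions L z" "B = B_positions L z"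
  define V where "V = sites L - A - B"
  have sub: "A \<subseteq> sites L" "B \<subseteq> sites L" "A \<inter> B = {}" "card A = N'" "card B = M'"
    using positions_in_disjoint_pairs[OF z] by (auto simp: AB mem_disjoint_pairs)
  have finV: "finite V" by (simp add: V_def finite_sites)
  have cardV: "card V = 2 * L - N' - M'"
  proof -
    have "B \<subseteq> sites L - A" "finite A" "finite B"
      using sub by (auto intro: finite_subset finite_sites)
    thus ?thesis using sub by (simp add: V_def card_Diff_subset card_sites)
  qed
  have "(\<Sum>\<eta>\<in>configs_NM L N M. weight L q \<eta> * Q_config L q z \<eta>) =
      (\<Sum>(X, Y)\<in>disjoint_pairs (sites L) N M. q powi pair_exponent (sites L) X Y
         * (if A \<subseteq> X \<and> B \<subseteq> Y then q powi (order_balance A X - order_balance B Y) else 0))"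
    unfolding Q_config_eq[OF assms(1)] weight_eq_pair_exponent AB by (rule sum_configs_NM)
  also have "\<dots> = (\<Sum>(X, Y)\<in>disjoint_pairs (sites L) N M. if A \<subseteq> X \<and> B \<subseteq> Y
      then (\<lambda>(X, Y). q powi (pair_exponent (sites L) X Y + order_balance A X - order_balance B Y))
        (X, Y) else 0)"
    using assms(1) by (intro sum.cong refl) (auto simp: power_int_add power_int_diff)
  also have "\<dots> = (\<Sum>(D, E)\<in>disjoint_pairs V (N - N') (M - M').
      q powi (pair_exponent (sites L) (A \<union> D) (B \<union> E)
        + order_balance A (A \<union> D) - order_balance B (B \<union> E)))"
    using sub assms finite_sites[of L] by (subst sum_over_extensions) (simp_all add: V_def)
  also have "\<dots> = (\<Sum>(D, E)\<in>disjoint_pairs V (N - N') (M - M').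
      q powi pair_exponent (sites L) A B * q powi pair_exponent V D E)"
  proof (intro sum.cong refl, clarify)
    fix D E assume "(D, E) \<in> disjoint_pairs V (N - N') (M - M')"
    hence "pair_exponent (sites L) (A \<union> D) (B \<union> E) + order_balance A (A \<union> D)
        - order_balance B (B \<union> E) = pair_exponent (sites L) A B + pair_exponent V D E"
      using sub unfolding V_def mem_disjoint_pairs
      by (intro pair_exponent_Un finite_sites) auto
    thus "q powi (pair_exponent (sites L) (A \<union> D) (B \<union> E) + order_balance A (A \<union> D)
        - order_balance B (B \<union> E)) = q powi pair_exponent (sites L) A B * q powi pair_exponent V D E"
      using assms(1) by (simp add: power_int_add)
  qed
  also have "\<dots> = q powi pair_exponent (sites L) A B
      * (\<Sum>(D, E)\<in>disjoint_pairs V (N - N') (M - M'). q powi pair_exponent V D E)"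
    by (simp add: sum_distrib_left case_prod_unfold)
  also have "(\<Sum>(D, E)\<in>disjoint_pairs V (N - N') (M - M'). q powi pair_exponent V D E) =
      q_fact q (2 * L - N' - M')
        / (q_fact q (N - N') * q_fact q (M - M') * q_fact q (2 * L - N - M))"
    using assms finV cardV
    by (subst sum_pair_exponent_eq_q_trinomial) (auto intro!: arg_cong[of _ _ "q_fact q"])
  finally show ?thesis by (simp add: weight_eq_pair_exponent AB)
qed

lemma Q_config_eq_0:
  assumes "0 < q" "z \<in> configs_NM L N' M'" "\<eta> \<in> configs_NM L N M" "\<not> (N' \<le> N \<and> M' \<le> M)"
  shows "Q_config L q z \<eta> = 0"
proof -
  have "finite (A_positions L \<eta>)" "finite (B_positions L \<eta>)"
    by (auto simp: A_positions_def B_positions_def finite_sites)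
  hence "\<not> (A_positions L z \<subseteq> A_positions L \<eta> \<and> B_positions L z \<subseteq> B_positions L \<eta>)"
    using assms(2-4) by (auto simp: configs_NM_def dest: card_mono)
  thus ?thesis by (simp only: Q_config_eq[OF assms(1)] if_False)
qed

theorem theorem3p5:
  fixes L N M N' M' :: nat and r l q :: real
  assumes "L \<ge> 1"
    and "0 < r" and "0 < l"
    and "q = sqrt (r / l)"
    and "N + M \<le> 2 * L" and "N' + M' \<le> 2 * L"
  shows "\<exists>lam::real. \<forall>z\<in>configs_NM L N' M'. \<forall>\<eta>\<in>configs_NM L N M.
      inverse (stationary L q N' M' z) *
          (\<Sum>\<eta>'\<in>configs_NM L N M. stationary L q N M \<eta>' * Q_config L q z \<eta>')
        = (\<Sum>z'\<in>configs_NM L N' M'. Q_config L q z' \<eta>)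
      \<and> (\<Sum>z'\<in>configs_NM L N' M'. Q_config L q z' \<eta>) = lam"
proof (cases "N' \<le> N \<and> M' \<le> M")
  \<comment> \<open>If \<open>z\<close> has more particles of some species than \<open>\<eta>\<close>, every \<open>Q_config\<close> in both sums vanishes.\<close>
  case False
  have "0 < q" using assms by simp
  show ?thesis
    by (intro exI[of _ 0] ballI) (simp add: Q_config_eq_0[OF \<open>0 < q\<close> _ _ False])
next
  case True
  have q: "0 < q" using assms by simp
  have nz: "q_fact q n \<noteq> 0" for n using q_fact_pos[OF q, of n] by simp
  \<comment> \<open>The product of the quantum binomial coefficients of \<open>N\<close> over \<open>N'\<close> and of \<open>M\<close> over \<open>M'\<close>.\<close>
  define lam where "lam = q_fact q N / (q_fact q N' * q_fact q (N - N'))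
    * (q_fact q M / (q_fact q M' * q_fact q (M - M')))"
  show ?thesis
  proof (intro exI[of _ lam] ballI)
    fix z \<eta> assume z: "z \<in> configs_NM L N' M'" and \<eta>: "\<eta> \<in> configs_NM L N M"
    have card: "finite (A_positions L \<eta>)" "finite (B_positions L \<eta>)"
      "card (A_positions L \<eta>) = N" "card (B_positions L \<eta>) = M"
      using \<eta> by (auto simp: configs_NM_def A_positions_def B_positions_def finite_sites)
    have right: "(\<Sum>z'\<in>configs_NM L N' M'. Q_config L q z' \<eta>) = lam"
      unfolding sum_Q_config_over_z[OF q \<eta>] lam_def
      using card True q by (simp add: q_subset_sum_eq_q_binomial q_fact_inverse)
    have "(\<Sum>\<eta>'\<in>configs_NM L N M. stationary L q N M \<eta>' * Q_config L q z \<eta>') =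
        (\<Sum>\<eta>'\<in>configs_NM L N M. weight L q \<eta>' * Q_config L q z \<eta>') / partition_function L q N M"
      by (simp add: stationary_def sum_divide_distrib)
    also have "inverse (stationary L q N' M' z) * \<dots> = lam"
    proof -
      have "weight L q z \<noteq> 0" using q by (simp add: weight_eq_pair_exponent)
      thus ?thesis
        using sum_weight_Q_config[OF q z, of N M] True assms(5) z nz
        by (simp add: stationary_def partition_function_def lam_def field_simps)
    qed
    finally show "inverse (stationary L q N' M' z) *
          (\<Sum>\<eta>'\<in>configs_NM L N M. stationary L q N M \<eta>' * Q_config L q z \<eta>')
        = (\<Sum>z'\<in>configs_NM L N' M'. Q_config L q z' \<eta>)
      \<and> (\<Sum>z'\<in>configs_NM L N' M'. Q_config L q z' \<eta>) = lam"
      using right by simp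
  qed
qed

end
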